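(* In $\mathbf{sNSym}$ we have $\Psi_0=R_{(\dot0)}$, and for every $n\ge1$, $\Psi_n=(-1)^nR_{(1^n,\dot0)}$, where $(1^n,\dot0)$ denotes the dotted composition $(1,\ldots,1,\dot0)$ with $n$ ones.
   Context: Let $\mathbb N=\{1,2,\ldots\}$ and $\dot{\mathbb N}_0=\{\dot0,\dot1,\dot2,\ldots\}$ (dotted copies of the nonnegative integers). A dotted composition is a finite tuple $\alpha=(\alpha_1,\ldots,\alpha_k)$ with entries in $\mathbb N\cup\dot{\mathbb N}_0$. For entries not both dotted put $m\oplus n=m+n$ and $m\oplus\dot n=\dot m\oplus n=\dot r$ with $r=m+n$. The partial order $\preceq$ on dotted compositions is the reflexive-transitive closure of the relation: $\beta$ is obtained from $\alpha$ by replacing two consecutive entries $x,y$ of $\alpha$ that are not both dotted by the single entry $x\oplus y$ (then $\alpha\preceq\beta$). $\mathbf{sNSym}$, as an algebra, is the free associative unital $\mathbb Q$-algebra on generators $H_n$ ($n\in\mathbb N$) and $H_{\dot n}=\tilde H_n$ ($n\ge0$); $H_\alpha:=H_{\alpha_1}\cdots H_{\alpha_k}$. The noncommutative Ribbon Schur functions in superspace $R_\alpha$ are defined recursively by $R_\alpha=H_\alpha-\sum_{\alpha\prec\beta}R_\beta$. The elements $\Psi_n$ are defined by $\Psi_0=\tilde H_0$ and $\Psi_n=\tilde H_n-\sum_{k=0}^{n-1}H_{n-k}\Psi_k$ for $n\ge1$. *)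

theory Defs
  imports Complex_Main "HOL-Library.Poly_Mapping"
begin

typedef pnat = "{n::nat. 0 < n}" morphisms nat_of_pnat pnat_of_nat
  by blast

setup_lifting type_definition_pnat

instantiation pnat :: "{one, plus}"
begin

lift_definition one_pnat :: pnat is "1::nat" by simp
lift_definition plus_pnat :: "pnat \<Rightarrow> pnat \<Rightarrow> pnat" is "(+)" by simp

instance ..

end

datatype entry = Undotted pnat | is_dotted: Dotted nat

type_synonym dcomp = "entry list"

text \<open>The sum of two dotted entries is left unspecified; it is never used.\<close>

fun oplus :: "entry \<Rightarrow> entry \<Rightarrow> entry" (infixl "\<oplus>" 65) where
  "Undotted m \<oplus> Undotted n = Undotted (m + n)"
| "Undotted m \<oplus> Dotted n = Dotted (nat_of_pnat m + n)"
| "Dotted m \<oplus> Undotted n = Dotted (m + nat_of_pnat n)"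

inductive merge :: "dcomp \<Rightarrow> dcomp \<Rightarrow> bool" where
  "\<not> (is_dotted x \<and> is_dotted y) \<Longrightarrow> merge (us @ x # y # vs) (us @ (x \<oplus> y) # vs)"

definition dle :: "dcomp \<Rightarrow> dcomp \<Rightarrow> bool" (infix "\<preceq>" 50) where
  "\<alpha> \<preceq> \<beta> \<longleftrightarrow> merge\<^sup>*\<^sup>* \<alpha> \<beta>"

definition dless :: "dcomp \<Rightarrow> dcomp \<Rightarrow> bool" (infix "\<prec>" 50) where
  "\<alpha> \<prec> \<beta> \<longleftrightarrow> \<alpha> \<preceq> \<beta> \<and> \<alpha> \<noteq> \<beta>"

lemma merge_length: "merge \<alpha> \<beta> \<Longrightarrow> length \<alpha> = Suc (length \<beta>)"
  by (auto elim: merge.cases)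

lemma dle_length: "\<alpha> \<preceq> \<beta> \<Longrightarrow> length \<beta> \<le> length \<alpha>"
  unfolding dle_def by (induction rule: rtranclp_induct) (auto dest: merge_length)

lemma dless_length: "\<alpha> \<prec> \<beta> \<Longrightarrow> length \<beta> < length \<alpha>"
  unfolding dless_def dle_def
  by (metis Suc_le_lessD dle_def dle_length converse_rtranclpE merge_length less_Suc_eq_le)

lemma finite_merge: "finite {\<beta>. merge \<alpha> \<beta>}"
proof -
  have "{\<beta>. merge \<alpha> \<beta>} \<subseteq>
      (\<lambda>i. take i \<alpha> @ (\<alpha> ! i \<oplus> \<alpha> ! Suc i) # drop (Suc (Suc i)) \<alpha>) ` {..length \<alpha>}"
  proof
    fix \<beta> assume "\<beta> \<in> {\<beta>. merge \<alpha> \<beta>}"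
    then have "merge \<alpha> \<beta>" by simp
    then obtain us x y vs where
      "\<alpha> = us @ x # y # vs" "\<beta> = us @ (x \<oplus> y) # vs"
      by (cases rule: merge.cases) blast
    then show "\<beta> \<in> (\<lambda>i. take i \<alpha> @ (\<alpha> ! i \<oplus> \<alpha> ! Suc i) # drop (Suc (Suc i)) \<alpha>) ` {..length \<alpha>}"
      by (intro image_eqI[of _ _ "length us"]) (auto simp: nth_append)
  qed
  then show ?thesis by (rule finite_subset) simp
qed

text \<open>So the sum in the recursion for the ribbon functions below is a genuine finite sum.\<close>

lemma finite_dless: "finite {\<beta>. \<alpha> \<prec> \<beta>}"
proof -
  have "finite {\<beta>. \<alpha> \<preceq> \<beta>}"
  proof (induction "length \<alpha>" arbitrary: \<alpha> rule: less_induct)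
    case less
    have "{\<beta>. \<alpha> \<preceq> \<beta>} = insert \<alpha> (\<Union>\<gamma>\<in>{\<gamma>. merge \<alpha> \<gamma>}. {\<beta>. \<gamma> \<preceq> \<beta>})"
      unfolding dle_def by (auto elim: converse_rtranclpE intro: converse_rtranclp_into_rtranclp)
    moreover have "finite (\<Union>\<gamma>\<in>{\<gamma>. merge \<alpha> \<gamma>}. {\<beta>. \<gamma> \<preceq> \<beta>})"
      using less finite_merge by (auto dest: merge_length)
    ultimately show ?case by simp
  qed
  then show ?thesis by (rule rev_finite_subset) (auto simp: dless_def)
qed

text \<open>The free monoid on a type of letters, written additively so that its monoid algebra is
  available as \<open>_ \<Rightarrow>\<^sub>0 _\<close>.\<close>

datatype 'a word = Word (letters: "'a list")

instantiation word :: (type) monoid_add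
begin

definition zero_word :: "'a word" where "0 = Word []"
definition plus_word :: "'a word \<Rightarrow> 'a word \<Rightarrow> 'a word"
  where "u + v = Word (letters u @ letters v)"

instance by standard (simp_all add: zero_word_def plus_word_def)

end

text \<open>The free associative unital \<open>\<rat>\<close>-algebra on the generators indexed by \<^typ>\<open>entry\<close> is the
  monoid algebra over \<open>\<rat>\<close> of the free monoid on \<^typ>\<open>entry\<close>.\<close>

type_synonym sNSym = "entry word \<Rightarrow>\<^sub>0 rat"

definition gen :: "entry \<Rightarrow> sNSym" where
  "gen e = Poly_Mapping.single (Word [e]) 1"

definition H :: "dcomp \<Rightarrow> sNSym" where
  "H \<alpha> = prod_list (map gen \<alpha>)"

function R :: "dcomp \<Rightarrow> sNSym" where
  "R \<alpha> = H \<alpha> - (\<Sum>\<beta> | \<alpha> \<prec> \<beta>. R \<beta>)"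
  by auto
termination
  by (relation "measure length") (auto dest: dless_length)

declare R.simps [simp del]

text \<open>\<open>pnat_of_nat\<close> is only meaningful at positive arguments; here \<open>n - k > 0\<close>.\<close>

function \<Psi> :: "nat \<Rightarrow> sNSym" where
  "\<Psi> n = (if n = 0 then gen (Dotted 0)
          else gen (Dotted n) - (\<Sum>k<n. gen (Undotted (pnat_of_nat (n - k))) * \<Psi> k))"
  by auto
termination
  by (relation "measure id") auto

declare \<Psi>.simps [simp del]

end

theory Submission
  imports Defs
begin

text \<open>
  Multiplication by a single undotted generator obeys the ribbon rule
  \<open>H\<^sub>p R\<^sub>\<alpha> = R\<^sub>p\<^sub>\<cdot>\<^sub>\<alpha> + R\<^sub>p\<^sub>\<odot>\<^sub>\<alpha>\<close>, where \<open>p\<cdot>\<alpha>\<close> prepends \<open>p\<close> to the nonempty \<open>\<alpha>\<close> and \<open>p\<odot>\<alpha>\<close> adds \<open>p\<close> to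
  its first entry (\<open>gen_mult_R\<close>). The reason is that an undotted entry can always be merged to the
  right, so the elements above \<open>p\<cdot>\<alpha>\<close> are exactly the \<open>p\<cdot>\<gamma>\<close> and the \<open>p\<odot>\<gamma>\<close> with \<open>\<alpha> \<preceq> \<gamma>\<close>
  (\<open>up_set_Cons\<close>), each obtained once because \<open>\<oplus>\<close> is cancellative. The rule follows by comparing the expansions of
  \<open>H\<^sub>p H\<^sub>\<alpha> = H\<^sub>p\<^sub>\<cdot>\<^sub>\<alpha>\<close> into ribbons.

  Applied to \<open>\<alpha> = (1\<^sup>k,0)\<close> with its last entry dotted, the rule writes
  \<open>H\<^sub>n\<^sub>-\<^sub>k R\<^sub>\<alpha>\<close> as the sum of two consecutive members of the family of hooks
  \<open>(n)\<close> (dotted), \<open>(n,0)\<close>, \<open>(n-1,1,0)\<close>, \<dots>, \<open>(1\<^sup>n,0)\<close>. With the signs \<open>(-1)\<^sup>k\<close> supplied by the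
  induction hypothesis, the sum in the recursion for \<open>\<Psi>\<close> telescopes: the first hook contributes
  \<open>R\<^sub>n = H\<^sub>n\<close> for the dotted \<open>n\<close>, which cancels the leading term of the recursion, and the last one
  is the asserted value.
\<close>

section \<open>The order above a composition with undotted first entry\<close>

lemma is_dotted_oplus_Undotted [simp]: "is_dotted (Undotted p \<oplus> x) \<longleftrightarrow> is_dotted x"
  by (cases x) auto

lemma oplus_assoc_Undotted:
  assumes "\<not> (is_dotted x \<and> is_dotted y)"
  shows "Undotted p \<oplus> x \<oplus> y = Undotted p \<oplus> (x \<oplus> y)"
proof -
  have "p + q + r = p + (q + r)" for p q r :: pnat
    by transfer simp
  then show ?thesis
    using assms by (cases x; cases y) (auto simp: plus_pnat.rep_eq)
qed

lemma oplus_Undotted_cancel: "Undotted p \<oplus> x = Undotted p \<oplus> y \<longleftrightarrow> x = y"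
proof -
  have "p + q = p + r \<longleftrightarrow> q = r" for p q r :: pnat
    by transfer simp
  then show ?thesis by (cases x; cases y) auto
qed

text \<open>Adding a dotted zero is not the identity: it puts a dot on the other summand.\<close>

lemma oplus_Undotted_neq: "Undotted p \<oplus> x \<noteq> Undotted p"
proof -
  have "p + q \<noteq> p" for p q :: pnat
    by transfer simp
  then show ?thesis by (cases x) auto
qed

lemma merge_Cons_iff:
  "merge (x # t) \<beta> \<longleftrightarrow>
     (\<exists>y vs. t = y # vs \<and> \<not> (is_dotted x \<and> is_dotted y) \<and> \<beta> = (x \<oplus> y) # vs) \<or>
     (\<exists>t'. merge t t' \<and> \<beta> = x # t')" (is "?L \<longleftrightarrow> ?R")
proof
  assume ?L
  then show ?R
  proof (cases rule: merge.cases)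
    case (1 y z us vs)
    then show ?thesis
      by (cases us) (auto intro: merge.intros)
  qed
next
  assume ?R
  then show ?L
  proof (elim disjE exE conjE)
    fix y vs assume "t = y # vs" "\<not> (is_dotted x \<and> is_dotted y)" "\<beta> = (x \<oplus> y) # vs"
    then show ?L
      using merge.intros[of x y "[]" vs] by simp
  next
    fix t' assume "merge t t'" "\<beta> = x # t'"
    then show ?L
      by (metis append_Cons merge.cases merge.intros)
  qed
qed

lemma not_merge_singleton: "\<not> merge [x] \<beta>"
  by (auto simp: merge_Cons_iff elim: merge.cases)

lemma dle_refl: "\<alpha> \<preceq> \<alpha>"
  by (simp add: dle_def)

lemma dle_merge: "\<alpha> \<preceq> \<beta> \<Longrightarrow> merge \<beta> \<gamma> \<Longrightarrow> \<alpha> \<preceq> \<gamma>"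
  by (simp add: dle_def)

lemma dle_Cons: "\<alpha> \<preceq> \<beta> \<Longrightarrow> x # \<alpha> \<preceq> x # \<beta>"
  unfolding dle_def
  by (induction rule: rtranclp_induct) (auto simp: merge_Cons_iff intro: rtranclp.rtrancl_into_rtrancl)

lemma dle_nonempty:
  assumes "\<alpha> \<preceq> \<beta>" "\<alpha> \<noteq> []"
  shows "\<beta> \<noteq> []"
  using assms unfolding dle_def
  by (induction rule: rtranclp_induct) (auto elim: merge.cases)

definition add_to_hd :: "pnat \<Rightarrow> dcomp \<Rightarrow> dcomp" where
  "add_to_hd p \<gamma> = (Undotted p \<oplus> hd \<gamma>) # tl \<gamma>"

text \<open>Merging \<open>p\<close> into the first entry commutes with all other merges, by associativity, and it is
  never obstructed since \<open>p\<close> carries no dot. Hence in a chain of merges the one involving \<open>p\<close>, if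
  there is one, can be postponed to the end.\<close>

lemma up_set_Cons:
  assumes "\<alpha> \<noteq> []"
  shows "{\<beta>. Undotted p # \<alpha> \<preceq> \<beta>} =
    (#) (Undotted p) ` {\<gamma>. \<alpha> \<preceq> \<gamma>} \<union> add_to_hd p ` {\<gamma>. \<alpha> \<preceq> \<gamma>}" (is "_ = ?A \<union> ?B")
proof (intro equalityI subsetI)
  fix \<beta> assume "\<beta> \<in> {\<beta>. Undotted p # \<alpha> \<preceq> \<beta>}"
  then have "merge\<^sup>*\<^sup>* (Undotted p # \<alpha>) \<beta>"
    by (simp add: dle_def)
  then show "\<beta> \<in> ?A \<union> ?B"
  proof (induction rule: rtranclp_induct)
    case base
    then show ?case by (simp add: dle_refl)
  next
    case (step \<beta> \<beta>')
    from step.IH obtain \<gamma> where \<gamma>: "\<alpha> \<preceq> \<gamma>" "\<beta> = Undotted p # \<gamma> \<or> \<beta> = add_to_hd p \<gamma>"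
      by blast
    obtain x t where xt: "\<gamma> = x # t"
      using dle_nonempty[OF \<gamma>(1) assms] by (cases \<gamma>) auto
    from \<gamma>(2) show ?case
    proof
      assume "\<beta> = Undotted p # \<gamma>"
      with step.hyps(2) have "\<beta>' = add_to_hd p \<gamma> \<or> (\<exists>\<gamma>'. merge \<gamma> \<gamma>' \<and> \<beta>' = Undotted p # \<gamma>')"
        by (auto simp: merge_Cons_iff[of "Undotted p"] xt add_to_hd_def)
      then show ?thesis
        using \<gamma>(1) by (auto intro: dle_merge)
    next
      assume "\<beta> = add_to_hd p \<gamma>"
      with step.hyps(2) have "\<exists>\<gamma>'. merge \<gamma> \<gamma>' \<and> \<beta>' = add_to_hd p \<gamma>'"
        by (auto simp: merge_Cons_iff[of _ t] xt add_to_hd_def oplus_assoc_Undotted)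
      then show ?thesis
        using \<gamma>(1) by (auto intro: dle_merge)
    qed
  qed
next
  fix \<beta> assume "\<beta> \<in> ?A \<union> ?B"
  then obtain \<gamma> where \<gamma>: "\<alpha> \<preceq> \<gamma>" "\<beta> = Undotted p # \<gamma> \<or> \<beta> = add_to_hd p \<gamma>"
    by blast
  have "merge (Undotted p # \<gamma>) (add_to_hd p \<gamma>)"
    using dle_nonempty[OF \<gamma>(1) assms] by (cases \<gamma>) (auto simp: merge_Cons_iff add_to_hd_def)
  then show "\<beta> \<in> {\<beta>. Undotted p # \<alpha> \<preceq> \<beta>}"
    using \<gamma> dle_Cons[OF \<gamma>(1)] by (auto intro: dle_merge)
qed

section \<open>Ribbons times an undotted generator\<close>

lemma up_set_eq_insert: "{\<beta>. \<alpha> \<preceq> \<beta>} = insert \<alpha> {\<beta>. \<alpha> \<prec> \<beta>}"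
  by (auto simp: dless_def dle_refl)

lemma finite_up_set: "finite {\<beta>. \<alpha> \<preceq> \<beta>}"
  by (simp add: up_set_eq_insert finite_dless)

lemma sum_up_set:
  fixes f :: "dcomp \<Rightarrow> 'a::comm_monoid_add"
  shows "(\<Sum>\<beta> | \<alpha> \<preceq> \<beta>. f \<beta>) = f \<alpha> + (\<Sum>\<beta> | \<alpha> \<prec> \<beta>. f \<beta>)"
proof -
  have "\<alpha> \<notin> {\<beta>. \<alpha> \<prec> \<beta>}"
    by (simp add: dless_def)
  then show ?thesis
    unfolding up_set_eq_insert by (rule sum.insert[OF finite_dless])
qed

lemma H_eq_sum_R: "H \<alpha> = (\<Sum>\<beta> | \<alpha> \<preceq> \<beta>. R \<beta>)"
  by (simp add: sum_up_set R.simps[of \<alpha>])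

lemma R_singleton: "R [x] = gen x"
proof -
  have "{\<beta>. [x] \<prec> \<beta>} = {}"
    by (auto simp: dless_def dle_def not_merge_singleton elim: converse_rtranclpE)
  then have "R [x] = H [x]"
    by (subst R.simps) (simp only: sum.empty diff_zero)
  then show ?thesis by (simp add: H_def)
qed

lemma H_Cons_eq_sum_R:
  assumes "\<alpha> \<noteq> []"
  shows "H (Undotted p # \<alpha>) = (\<Sum>\<gamma> | \<alpha> \<preceq> \<gamma>. R (Undotted p # \<gamma>) + R (add_to_hd p \<gamma>))"
proof -
  let ?U = "{\<gamma>. \<alpha> \<preceq> \<gamma>}"
  have "inj_on (add_to_hd p) ?U"
  proof (rule inj_onI)
    fix \<gamma> \<delta> assume "\<gamma> \<in> ?U" "\<delta> \<in> ?U" "add_to_hd p \<gamma> = add_to_hd p \<delta>"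
    then show "\<gamma> = \<delta>"
      using dle_nonempty[of \<alpha> \<gamma>] dle_nonempty[of \<alpha> \<delta>] assms
      by (simp add: add_to_hd_def oplus_Undotted_cancel list.expand)
  qed
  moreover have "(#) (Undotted p) ` ?U \<inter> add_to_hd p ` ?U = {}"
    using oplus_Undotted_neq[of p] by (auto simp: add_to_hd_def) metis
  ultimately show ?thesis
    by (simp add: H_eq_sum_R[of "Undotted p # \<alpha>"] up_set_Cons[OF assms] sum.union_disjoint finite_up_set
        sum.reindex sum.distrib)
qed

text \<open>Both sides, summed over all \<open>\<gamma> \<succeq> \<alpha>\<close>, give \<open>H\<^sub>p H\<^sub>\<alpha>\<close>. The terms with \<open>\<gamma> \<noteq> \<alpha>\<close> agree by
  induction on the length, so those with \<open>\<gamma> = \<alpha>\<close> agree too.\<close>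

lemma gen_mult_R:
  assumes "\<alpha> \<noteq> []"
  shows "gen (Undotted p) * R \<alpha> = R (Undotted p # \<alpha>) + R (add_to_hd p \<alpha>)"
  using assms
proof (induction \<alpha> rule: measure_induct_rule[of length])
  case (less \<alpha>)
  let ?f = "\<lambda>\<gamma>. gen (Undotted p) * R \<gamma>" and ?g = "\<lambda>\<gamma>. R (Undotted p # \<gamma>) + R (add_to_hd p \<gamma>)"
  have above: "sum ?f {\<gamma>. \<alpha> \<prec> \<gamma>} = sum ?g {\<gamma>. \<alpha> \<prec> \<gamma>}"
  proof (rule sum.cong)
    fix \<gamma> assume "\<gamma> \<in> {\<gamma>. \<alpha> \<prec> \<gamma>}"
    then show "?f \<gamma> = ?g \<gamma>"
      using less.IH[of \<gamma>] dless_length[of \<alpha> \<gamma>] dle_nonempty[of \<alpha> \<gamma>] less.prems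
      by (simp add: dless_def)
  qed simp
  have "sum ?f {\<gamma>. \<alpha> \<preceq> \<gamma>} = H (Undotted p # \<alpha>)"
    by (simp add: sum_distrib_left[symmetric] H_eq_sum_R[symmetric]) (simp add: H_def)
  also have "\<dots> = sum ?g {\<gamma>. \<alpha> \<preceq> \<gamma>}"
    by (rule H_Cons_eq_sum_R[OF less.prems])
  finally have "?f \<alpha> + sum ?f {\<gamma>. \<alpha> \<prec> \<gamma>} = ?g \<alpha> + sum ?g {\<gamma>. \<alpha> \<prec> \<gamma>}"
    by (simp only: sum_up_set)
  then show ?case
    unfolding above by simp
qed

section \<open>Telescoping over hooks\<close>

text \<open>Member number \<open>k\<close> of the hooks of weight \<open>n\<close>. The dotted one-part composition is placed at
  \<open>k = 0\<close>, so that the two terms of the ribbon rule are consecutive members for every \<open>k\<close>.\<close>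

fun hook :: "nat \<Rightarrow> nat \<Rightarrow> dcomp" where
  "hook n 0 = [Dotted n]"
| "hook n (Suc k) = Undotted (pnat_of_nat (n - k)) # replicate k (Undotted 1) @ [Dotted 0]"

lemma pnat_of_nat_Suc_0: "pnat_of_nat (Suc 0) = 1"
  by (simp add: one_pnat_def)

lemma hook_self: "hook n n = replicate n (Undotted 1) @ [Dotted 0]"
  by (cases n) (auto simp: pnat_of_nat_Suc_0)

lemma pnat_of_nat_plus_one: "0 < m \<Longrightarrow> pnat_of_nat m + 1 = pnat_of_nat (Suc m)"
  by (simp add: nat_of_pnat_inject[symmetric] plus_pnat.rep_eq one_pnat.rep_eq
      pnat_of_nat_inverse)

lemma gen_mult_R_hook:
  assumes "k < n"
  shows "gen (Undotted (pnat_of_nat (n - k))) * R (hook k k) = R (hook n k) + R (hook n (Suc k))"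
proof -
  have "add_to_hd (pnat_of_nat (n - k)) (hook k k) = hook n k"
  proof (cases k)
    case 0
    then show ?thesis
      using assms by (simp add: add_to_hd_def pnat_of_nat_inverse)
  next
    case (Suc j)
    then show ?thesis
      using assms pnat_of_nat_plus_one[of "n - k"]
      by (simp add: add_to_hd_def pnat_of_nat_Suc_0 Suc_diff_Suc)
  qed
  moreover have "Undotted (pnat_of_nat (n - k)) # hook k k = hook n (Suc k)"
    by (simp add: hook_self)
  moreover have "hook k k \<noteq> []"
    by (simp add: hook_self)
  ultimately show ?thesis
    using gen_mult_R[of "hook k k" "pnat_of_nat (n - k)"]
    by (metis add.commute)
qed

lemma \<Psi>_eq_R_hook: "\<Psi> n = (- 1) ^ n * R (hook n n)"
proof (induction n rule: less_induct)
  case (less n)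
  let ?s = "\<lambda>k. (- 1) ^ k * R (hook n k)"
  have step: "gen (Undotted (pnat_of_nat (n - k))) * \<Psi> k = ?s k - ?s (Suc k)" if "k < n" for k
  proof -
    have "gen (Undotted (pnat_of_nat (n - k))) * \<Psi> k =
        (- 1) ^ k * (gen (Undotted (pnat_of_nat (n - k))) * R (hook k k))"
      using less.IH[OF that] by (simp add: minus_one_power_iff)
    then show ?thesis
      by (simp add: gen_mult_R_hook[OF that] distrib_left)
  qed
  have "(\<Sum>k<n. gen (Undotted (pnat_of_nat (n - k))) * \<Psi> k) = (\<Sum>k<n. ?s k - ?s (Suc k))"
    by (intro sum.cong) (auto simp: step)
  also have "\<dots> = gen (Dotted n) - ?s n"
    using sum_lessThan_telescope'[of ?s n] by (simp add: R_singleton)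
  finally have sum_eq: "(\<Sum>k<n. gen (Undotted (pnat_of_nat (n - k))) * \<Psi> k) = gen (Dotted n) - ?s n" .
  show ?case
  proof (cases "n = 0")
    case True
    have "\<Psi> 0 = gen (Dotted 0)"
      by (subst \<Psi>.simps) (simp only: if_True refl)
    then show ?thesis
      using True by (simp add: R_singleton)
  next
    case False
    then have "\<Psi> n = gen (Dotted n) - (gen (Dotted n) - ?s n)"
      by (subst \<Psi>.simps) (simp only: if_False sum_eq)
    then show ?thesis by simp
  qed
qed

theorem proposition6p6:
  shows "\<Psi> 0 = R [Dotted 0] \<and>
    (\<forall>n\<ge>1. \<Psi> n = (- 1) ^ n * R (replicate n (Undotted 1) @ [Dotted 0]))"
  using \<Psi>_eq_R_hook[of 0] by (simp add: \<Psi>_eq_R_hook hook_self)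

end
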